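(* Let $G$ be a Hausdorff topological group. Then $G$ is amenable if and only if the following holds: for every finite subset $E \subseteq G$ and every uniformly continuous map $f \colon G_{r} \to [0,1]$, there exists a mean $\nu$ on $G_r$ such that $\nu(f \circ \lambda_{G}(g)) = \nu(f)$ for all $g \in E$.
   Context: $G_r$ denotes $G$ with its right uniformity. A function $f\colon G\to\mathbb{R}$ is uniformly continuous on $G_r$ if for every $\epsilon>0$ there is an identity neighborhood $U$ with $|f(x)-f(y)|\le\epsilon$ whenever $xy^{-1}\in U$; ${\rm UC}_b(G_r)$ is the space of bounded such functions. A mean on $G_r$ is a linear map $\nu\colon {\rm UC}_b(G_r)\to\mathbb{R}$ with $\inf_{x\in G} f(x)\le\nu(f)\le\sup_{x\in G} f(x)$ for all $f$. Put $\lambda_G(g)(x)=gx$ for $g,x\in G$. The topological group $G$ is amenable if there is a mean $\nu$ on $G_r$ with $\nu(f\circ\lambda_G(g))=\nu(f)$ for all $f\in{\rm UC}_b(G_r)$ and all $g\in G$. *)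

theory Defs
  imports "HOL-Analysis.Analysis"
begin

(* Groups are written additively, following the class topological_group_add, but they are
   not assumed to be commutative: x - y stands for x y\<inverse> and (+) g for the
   left translation x \<mapsto> g x. *)

definition right_uniformly_continuous :: "('a::topological_group_add \<Rightarrow> real) \<Rightarrow> bool" where
  "right_uniformly_continuous f \<longleftrightarrow>
     (\<forall>\<epsilon>>0. \<exists>U. 0 \<in> interior U \<and> (\<forall>x y. x - y \<in> U \<longrightarrow> \<bar>f x - f y\<bar> \<le> \<epsilon>))"

definition UCb :: "('a::topological_group_add \<Rightarrow> real) set" where
  "UCb = {f. right_uniformly_continuous f \<and> bounded (range f)}"

(* A mean is a functional on UCb; the values of \<nu> outside UCb are irrelevant. *)

definition is_mean :: "(('a::topological_group_add \<Rightarrow> real) \<Rightarrow> real) \<Rightarrow> bool" where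
  "is_mean \<nu> \<longleftrightarrow>
     (\<forall>f\<in>UCb. \<forall>h\<in>UCb. \<nu> (\<lambda>x. f x + h x) = \<nu> f + \<nu> h) \<and>
     (\<forall>f\<in>UCb. \<forall>c. \<nu> (\<lambda>x. c * f x) = c * \<nu> f) \<and>
     (\<forall>f\<in>UCb. (INF x. f x) \<le> \<nu> f \<and> \<nu> f \<le> (SUP x. f x))"

definition amenable :: "'a::topological_group_add itself \<Rightarrow> bool" where
  "amenable _ \<longleftrightarrow>
     (\<exists>\<nu> :: ('a \<Rightarrow> real) \<Rightarrow> real. is_mean \<nu> \<and> (\<forall>f\<in>UCb. \<forall>g. \<nu> (f \<circ> (+) g) = \<nu> f))"

end

theory Submission
  imports Defs
begin

text \<open>
  The backward direction rests on convolution of means. For means \<open>\<mu>\<close> and \<open>\<nu>\<close> put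
  \<open>(\<mu> * \<nu>)(f) = \<mu> (x \<mapsto> \<nu> (y \<mapsto> f (x y)))\<close>. The inner function, the average of \<open>f\<close> over
  \<open>\<nu>\<close>, is again bounded and uniformly continuous, because right translations preserve the
  right uniformity. Two observations show that convolution accumulates invariance. If \<open>\<nu>\<close> is
  invariant on \<open>f\<close> under all of \<open>G\<close>, then the average of \<open>f\<close> is constant, so
  \<open>\<mu> * \<nu>\<close> is invariant on \<open>f\<close> whatever \<open>\<mu>\<close> is (\<open>convolve_invariant_right\<close>). And since averaging
  commutes with left translations, \<open>\<mu> * \<nu>\<close> is invariant on \<open>f\<close> as soon as \<open>\<mu>\<close> is invariant on
  the average of \<open>f\<close> (\<open>convolve_invariant_left\<close>). Hence means that are invariant on one function
  at a time can be combined, one function after the other, into a mean that is invariant on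
  a given finite set of functions (\<open>finite_set_invariant_mean\<close>).

  The first observation needs invariance under the whole group, whereas the hypothesis
  provides it for finite sets of translations only. This gap, and the one between finite sets of
  functions and all functions, is closed by compactness of the set of means in the topology
  of pointwise convergence (\<open>invariant_mean_if_finitely\<close>). Finally, an arbitrary bounded
  uniformly continuous function is an affine image of a function with values in the unit
  interval, and means commute with affine maps. Comments write the group multiplicatively.
\<close>

section \<open>Bounded uniformly continuous functions\<close>

lemma UCbI:
  assumes "\<And>e. e > 0 \<Longrightarrow> \<exists>U. 0 \<in> interior U \<and> (\<forall>x y. x - y \<in> U \<longrightarrow> \<bar>f x - f y\<bar> \<le> e)"
    and "\<And>x. \<bar>f x\<bar> \<le> B"
  shows "f \<in> UCb"
  using assms unfolding UCb_def right_uniformly_continuous_def bounded_iff by auto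

lemma UCb_uniformD:
  assumes "f \<in> UCb" "e > 0"
  obtains U where "0 \<in> interior U" "\<And>x y. x - y \<in> U \<Longrightarrow> \<bar>f x - f y\<bar> \<le> e"
  using assms unfolding UCb_def right_uniformly_continuous_def by blast

lemma UCb_boundedD:
  assumes "f \<in> UCb"
  obtains B where "B > 0" "\<And>x. \<bar>f x\<bar> \<le> B"
  using assms unfolding UCb_def bounded_pos by auto

lemma UCb_const: "(\<lambda>x. c) \<in> UCb"
  by (rule UCbI[where B = "\<bar>c\<bar>"]) (auto intro: exI[of _ UNIV])

lemma UCb_add:
  assumes f: "f \<in> UCb" and h: "h \<in> UCb"
  shows "(\<lambda>x. f x + h x) \<in> UCb"
proof -
  obtain A where A: "\<And>x. \<bar>f x\<bar> \<le> A" using UCb_boundedD[OF f] by blast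
  obtain B where B: "\<And>x. \<bar>h x\<bar> \<le> B" using UCb_boundedD[OF h] by blast
  show ?thesis
  proof (rule UCbI[where B = "A + B"])
    fix e :: real assume "e > 0"
    then have e2: "e / 2 > 0" by simp
    obtain U where U: "0 \<in> interior U" "\<And>x y. x - y \<in> U \<Longrightarrow> \<bar>f x - f y\<bar> \<le> e / 2"
      using UCb_uniformD[OF f e2] by blast
    obtain V where V: "0 \<in> interior V" "\<And>x y. x - y \<in> V \<Longrightarrow> \<bar>h x - h y\<bar> \<le> e / 2"
      using UCb_uniformD[OF h e2] by blast
    have "\<bar>(f x + h x) - (f y + h y)\<bar> \<le> e" if "x - y \<in> U \<inter> V" for x y
    proof -
      have "\<bar>f x - f y\<bar> \<le> e / 2" "\<bar>h x - h y\<bar> \<le> e / 2" using U(2) V(2) that by auto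
      then show ?thesis by linarith
    qed
    moreover have "0 \<in> interior (U \<inter> V)" using U V by simp
    ultimately show "\<exists>W. 0 \<in> interior W \<and>
        (\<forall>x y. x - y \<in> W \<longrightarrow> \<bar>(f x + h x) - (f y + h y)\<bar> \<le> e)" by blast
  next
    show "\<bar>f x + h x\<bar> \<le> A + B" for x using A[of x] B[of x] by linarith
  qed
qed

lemma UCb_cmult:
  assumes f: "f \<in> UCb"
  shows "(\<lambda>x. c * f x) \<in> UCb"
proof -
  obtain A where A: "\<And>x. \<bar>f x\<bar> \<le> A" using UCb_boundedD[OF f] by blast
  show ?thesis
  proof (rule UCbI[where B = "\<bar>c\<bar> * A"])
    fix e :: real assume "e > 0"
    then have e2: "e / (\<bar>c\<bar> + 1) > 0" by simp
    obtain U where U: "0 \<in> interior U"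
        "\<And>x y. x - y \<in> U \<Longrightarrow> \<bar>f x - f y\<bar> \<le> e / (\<bar>c\<bar> + 1)"
      using UCb_uniformD[OF f e2] by blast
    have "\<bar>c * f x - c * f y\<bar> \<le> e" if "x - y \<in> U" for x y
    proof -
      have "\<bar>c * f x - c * f y\<bar> = \<bar>c\<bar> * \<bar>f x - f y\<bar>"
        by (simp add: abs_mult flip: right_diff_distrib)
      also have "\<dots> \<le> (\<bar>c\<bar> + 1) * (e / (\<bar>c\<bar> + 1))"
        using U(2)[OF that] by (intro mult_mono) auto
      also have "\<dots> = e" by simp
      finally show ?thesis .
    qed
    with U(1) show "\<exists>U. 0 \<in> interior U \<and>
        (\<forall>x y. x - y \<in> U \<longrightarrow> \<bar>c * f x - c * f y\<bar> \<le> e)" by blast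
  next
    show "\<bar>c * f x\<bar> \<le> \<bar>c\<bar> * A" for x using A[of x] by (simp add: abs_mult mult_left_mono)
  qed
qed

text \<open>The right uniformity is invariant under right translations only; a left translation by
  \<open>g\<close> conjugates the entourages by \<open>g\<close>, and conjugation is continuous.\<close>

lemma UCb_left_translate:
  fixes f :: "'a::topological_group_add \<Rightarrow> real"
  assumes f: "f \<in> UCb"
  shows "f \<circ> (+) g \<in> UCb"
proof -
  obtain A where A: "\<And>x. \<bar>f x\<bar> \<le> A" using UCb_boundedD[OF f] by blast
  show ?thesis
  proof (rule UCbI[where B = A])
    fix e :: real assume "e > 0"
    then obtain U where U: "0 \<in> interior U" "\<And>x y. x - y \<in> U \<Longrightarrow> \<bar>f x - f y\<bar> \<le> e"
      using UCb_uniformD[OF f] by blast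
    define V where "V = (\<lambda>z. g + z + - g) -` interior U"
    have "open V" unfolding V_def
      by (intro open_vimage open_interior continuous_intros)
    then have "0 \<in> interior V" using U(1) by (simp add: interior_open V_def)
    moreover have "\<bar>(f \<circ> (+) g) x - (f \<circ> (+) g) y\<bar> \<le> e" if "x - y \<in> V" for x y
    proof -
      have "(g + x) - (g + y) = g + (x - y) + - g"
        by (simp only: diff_conv_add_uminus minus_add add.assoc)
      then have "(g + x) - (g + y) \<in> U"
        using that interior_subset unfolding V_def by auto
      then show ?thesis using U(2) by simp
    qed
    ultimately show "\<exists>V. 0 \<in> interior V \<and>
        (\<forall>x y. x - y \<in> V \<longrightarrow> \<bar>(f \<circ> (+) g) x - (f \<circ> (+) g) y\<bar> \<le> e)" by blast
  qed (use A in simp)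
qed

section \<open>Means\<close>

lemma mean_add: "is_mean \<nu> \<Longrightarrow> f \<in> UCb \<Longrightarrow> h \<in> UCb \<Longrightarrow> \<nu> (\<lambda>x. f x + h x) = \<nu> f + \<nu> h"
  and mean_cmult: "is_mean \<nu> \<Longrightarrow> f \<in> UCb \<Longrightarrow> \<nu> (\<lambda>x. c * f x) = c * \<nu> f"
  unfolding is_mean_def by blast+

lemma mean_between:
  assumes "is_mean \<nu>" "f \<in> UCb" "\<And>x. a \<le> f x" "\<And>x. f x \<le> b"
  shows "a \<le> \<nu> f" "\<nu> f \<le> b"
proof -
  have "(INF x. f x) \<le> \<nu> f" "\<nu> f \<le> (SUP x. f x)"
    using assms(1,2) unfolding is_mean_def by blast+
  moreover have "a \<le> (INF x. f x)" "(SUP x. f x) \<le> b"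
    using assms(3,4) by (auto intro!: cINF_greatest cSUP_least)
  ultimately show "a \<le> \<nu> f" "\<nu> f \<le> b" by linarith+
qed

lemma mean_const: "is_mean \<nu> \<Longrightarrow> \<nu> (\<lambda>x. c) = c"
  using mean_between[OF _ UCb_const, of \<nu> c c c] by fastforce

lemma mean_diff_le:
  assumes \<nu>: "is_mean \<nu>" and f: "f \<in> UCb" and h: "h \<in> UCb" and e: "\<And>x. \<bar>f x - h x\<bar> \<le> e"
  shows "\<bar>\<nu> f - \<nu> h\<bar> \<le> e"
proof -
  have mh: "(\<lambda>x. -1 * h x) \<in> UCb" by (rule UCb_cmult[OF h])
  have d: "(\<lambda>x. f x + -1 * h x) \<in> UCb" by (rule UCb_add[OF f mh])
  have "\<nu> (\<lambda>x. f x + -1 * h x) = \<nu> f - \<nu> h"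
    using mean_add[OF \<nu> f mh] mean_cmult[OF \<nu> h, of "-1"] by simp
  moreover have "- e \<le> f x + -1 * h x" "f x + -1 * h x \<le> e" for x
    using e[of x] by linarith+
  ultimately show ?thesis using mean_between[OF \<nu> d, of "- e" e] by force
qed

lemma is_meanI:
  assumes "\<And>f h. f \<in> UCb \<Longrightarrow> h \<in> UCb \<Longrightarrow> \<nu> (\<lambda>x. f x + h x) = \<nu> f + \<nu> h"
    and "\<And>f c. f \<in> UCb \<Longrightarrow> \<nu> (\<lambda>x. c * f x) = c * \<nu> f"
    and "\<And>f a b. f \<in> UCb \<Longrightarrow> (\<And>x. a \<le> f x) \<Longrightarrow> (\<And>x. f x \<le> b) \<Longrightarrow> a \<le> \<nu> f \<and> \<nu> f \<le> b"
  shows "is_mean \<nu>"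
proof -
  have "(INF x. f x) \<le> \<nu> f \<and> \<nu> f \<le> (SUP x. f x)" if f: "f \<in> UCb" for f
  proof (rule assms(3)[OF f])
    have "bounded (range f)" using f by (simp add: UCb_def)
    then show "(INF x. f x) \<le> f x" "f x \<le> (SUP x. f x)" for x
      by (auto intro: cINF_lower cSUP_upper bounded_imp_bdd_below bounded_imp_bdd_above)
  qed
  with assms(1,2) show ?thesis unfolding is_mean_def by blast
qed

section \<open>Convolution of means\<close>

definition average :: "(('a::topological_group_add \<Rightarrow> real) \<Rightarrow> real) \<Rightarrow> ('a \<Rightarrow> real) \<Rightarrow> 'a \<Rightarrow> real"
  where "average \<nu> f x = \<nu> (f \<circ> (+) x)"

text \<open>The restriction to means of the Arens product on the dual space of \<^const>\<open>UCb\<close>.\<close>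

definition convolve ::
  "(('a::topological_group_add \<Rightarrow> real) \<Rightarrow> real) \<Rightarrow> (('a \<Rightarrow> real) \<Rightarrow> real) \<Rightarrow> ('a \<Rightarrow> real) \<Rightarrow> real"
  where "convolve \<mu> \<nu> f = \<mu> (average \<nu> f)"

text \<open>The average inherits the modulus of uniform continuity of \<open>f\<close>:
  \<open>x y\<close> and \<open>x' y\<close> are as close in the right uniformity as \<open>x\<close> and \<open>x'\<close>.\<close>

lemma average_UCb:
  fixes f :: "'a::topological_group_add \<Rightarrow> real"
  assumes \<nu>: "is_mean \<nu>" and f: "f \<in> UCb"
  shows "average \<nu> f \<in> UCb"
proof -
  obtain A where A: "\<And>x. \<bar>f x\<bar> \<le> A" using UCb_boundedD[OF f] by blast
  show ?thesis
  proof (rule UCbI[where B = A])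
    fix e :: real assume "e > 0"
    then obtain U where U: "0 \<in> interior U" "\<And>x y. x - y \<in> U \<Longrightarrow> \<bar>f x - f y\<bar> \<le> e"
      using UCb_uniformD[OF f] by blast
    have "\<bar>average \<nu> f x - average \<nu> f y\<bar> \<le> e" if "x - y \<in> U" for x y
      unfolding average_def
    proof (rule mean_diff_le[OF \<nu> UCb_left_translate[OF f] UCb_left_translate[OF f]])
      fix z
      have "(x + z) - (y + z) = x - y"
        by (simp only: diff_conv_add_uminus minus_add add.assoc add_minus_cancel)
      then show "\<bar>(f \<circ> (+) x) z - (f \<circ> (+) y) z\<bar> \<le> e"
        using U(2)[of "x + z" "y + z"] that by simp
    qed
    with U(1) show "\<exists>U. 0 \<in> interior U \<and>
        (\<forall>x y. x - y \<in> U \<longrightarrow> \<bar>average \<nu> f x - average \<nu> f y\<bar> \<le> e)" by blast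
  next
    have "- A \<le> f x" "f x \<le> A" for x using A[of x] by linarith+
    then show "\<bar>average \<nu> f x\<bar> \<le> A" for x
      using mean_between[OF \<nu> UCb_left_translate[OF f], of "- A" x A]
      unfolding average_def by (force simp: abs_le_iff)
  qed
qed

lemma convolve_is_mean:
  assumes \<mu>: "is_mean \<mu>" and \<nu>: "is_mean \<nu>"
  shows "is_mean (convolve \<mu> \<nu>)"
proof (rule is_meanI)
  fix f h :: "'a \<Rightarrow> real" assume fh: "f \<in> UCb" "h \<in> UCb"
  have "average \<nu> (\<lambda>x. f x + h x) = (\<lambda>x. average \<nu> f x + average \<nu> h x)"
    using mean_add[OF \<nu> UCb_left_translate[OF fh(1)] UCb_left_translate[OF fh(2)]]
    by (simp add: fun_eq_iff average_def comp_def)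
  then show "convolve \<mu> \<nu> (\<lambda>x. f x + h x) = convolve \<mu> \<nu> f + convolve \<mu> \<nu> h"
    unfolding convolve_def
    using mean_add[OF \<mu> average_UCb[OF \<nu> fh(1)] average_UCb[OF \<nu> fh(2)]] by simp
next
  fix f :: "'a \<Rightarrow> real" and c assume f: "f \<in> UCb"
  have "average \<nu> (\<lambda>x. c * f x) = (\<lambda>x. c * average \<nu> f x)"
    using mean_cmult[OF \<nu> UCb_left_translate[OF f]]
    by (simp add: fun_eq_iff average_def comp_def)
  then show "convolve \<mu> \<nu> (\<lambda>x. c * f x) = c * convolve \<mu> \<nu> f"
    unfolding convolve_def using mean_cmult[OF \<mu> average_UCb[OF \<nu> f]] by simp
next
  fix f :: "'a \<Rightarrow> real" and a b assume f: "f \<in> UCb" and ab: "\<And>x. a \<le> f x" "\<And>x. f x \<le> b"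
  have "a \<le> average \<nu> f x" "average \<nu> f x \<le> b" for x
    unfolding average_def using mean_between[OF \<nu> UCb_left_translate[OF f], of a x b] ab by auto
  then show "a \<le> convolve \<mu> \<nu> f \<and> convolve \<mu> \<nu> f \<le> b"
    unfolding convolve_def using mean_between[OF \<mu> average_UCb[OF \<nu> f]] by blast
qed

lemma average_left_translate: "average \<nu> (f \<circ> (+) g) = average \<nu> f \<circ> (+) g"
  by (simp add: fun_eq_iff average_def comp_def add.assoc)

text \<open>Averaging a function over a mean that is invariant on it gives a constant, and
  constants are fixed by left translations. Convolving from the left therefore preserves
  the invariance already achieved.\<close>

lemma convolve_invariant_right:
  assumes "\<And>g. \<nu> (f \<circ> (+) g) = \<nu> f"
  shows "convolve \<mu> \<nu> (f \<circ> (+) g) = convolve \<mu> \<nu> f"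
proof -
  have "average \<nu> f = (\<lambda>x. \<nu> f)" using assms by (simp add: fun_eq_iff average_def)
  then have "average \<nu> f \<circ> (+) g = average \<nu> f" by (simp add: comp_def)
  then show ?thesis by (simp add: convolve_def average_left_translate)
qed

lemma convolve_invariant_left:
  assumes "\<And>g. \<mu> (average \<nu> f \<circ> (+) g) = \<mu> (average \<nu> f)"
  shows "convolve \<mu> \<nu> (f \<circ> (+) g) = convolve \<mu> \<nu> f"
  using assms by (simp add: convolve_def average_left_translate)

text \<open>A new function \<open>f\<close> is added to the set \<open>F\<close> by convolving from the left with a mean that
  is invariant on the average of \<open>f\<close>, and not on \<open>f\<close> itself.\<close>

lemma finite_set_invariant_mean:
  fixes F :: "('a::topological_group_add \<Rightarrow> real) set"
  assumes single: "\<And>f :: 'a \<Rightarrow> real. f \<in> UCb \<Longrightarrow> \<exists>\<nu>. is_mean \<nu> \<and> (\<forall>g. \<nu> (f \<circ> (+) g) = \<nu> f)"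
    and "finite F" "F \<subseteq> UCb"
  shows "\<exists>\<nu>. is_mean \<nu> \<and> (\<forall>f\<in>F. \<forall>g. \<nu> (f \<circ> (+) g) = \<nu> f)"
  using \<open>finite F\<close> \<open>F \<subseteq> UCb\<close>
proof (induction F rule: finite_induct)
  case empty
  then show ?case using single[OF UCb_const[of 0]] by blast
next
  case (insert f F)
  from insert.IH insert.prems
  obtain \<nu> where \<nu>: "is_mean \<nu>" "\<forall>h\<in>F. \<forall>g. \<nu> (h \<circ> (+) g) = \<nu> h" by blast
  have "average \<nu> f \<in> UCb" using average_UCb[OF \<nu>(1)] insert.prems by blast
  then obtain \<mu> where \<mu>: "is_mean \<mu>" "\<forall>g. \<mu> (average \<nu> f \<circ> (+) g) = \<mu> (average \<nu> f)"
    using single by blast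
  have "convolve \<mu> \<nu> (h \<circ> (+) g) = convolve \<mu> \<nu> h" if "h \<in> insert f F" for h g
  proof (cases "h = f")
    case True
    then show ?thesis using convolve_invariant_left \<mu>(2) by blast
  next
    case False
    with that have "h \<in> F" by simp
    then show ?thesis using convolve_invariant_right \<nu>(2) by blast
  qed
  then show ?case using convolve_is_mean[OF \<mu>(1) \<nu>(1)] by blast
qed

section \<open>Compactness of the set of means\<close>

text \<open>Only the values on \<^const>\<open>UCb\<close> are constrained by \<^const>\<open>is_mean\<close>; setting the other
  values to 0 turns the set of means into a closed subset of a product of compact intervals.\<close>

lemma compact_normalized_means:
  "compact {\<nu> :: ('a::topological_group_add \<Rightarrow> real) \<Rightarrow> real. is_mean \<nu> \<and> (\<forall>f. f \<notin> UCb \<longrightarrow> \<nu> f = 0)}"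
    (is "compact ?M")
proof -
  define I where
    "I f = (if f \<in> UCb then {(INF x. f x)..(SUP x. f x)} else {0})" for f :: "'a \<Rightarrow> real"
  have "compactin (product_topology (\<lambda>f. euclidean) UNIV) (PiE UNIV I)"
    unfolding compactin_PiE I_def by (auto simp: I_def)
  then have cpt: "compact (PiE UNIV I)"
    by (simp add: euclidean_product_topology compactin_euclidean_iff)
  define L where "L = {\<nu> :: ('a \<Rightarrow> real) \<Rightarrow> real.
      (\<forall>f\<in>UCb. \<forall>h\<in>UCb. \<nu> (\<lambda>x. f x + h x) = \<nu> f + \<nu> h) \<and>
      (\<forall>f\<in>UCb. \<forall>c. \<nu> (\<lambda>x. c * f x) = c * \<nu> f)}"
  have "closed L"
    unfolding L_def Ball_def
    by (intro closed_Collect_conj closed_Collect_all closed_Collect_imp open_Collect_const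
        closed_Collect_eq continuous_intros continuous_on_product_coordinates)
  moreover have "?M = L \<inter> PiE UNIV I"
  proof (intro equalityI subsetI)
    fix \<nu> assume "\<nu> \<in> ?M"
    then show "\<nu> \<in> L \<inter> PiE UNIV I"
      unfolding is_mean_def L_def I_def PiE_UNIV_domain by auto
  next
    fix \<nu> assume "\<nu> \<in> L \<inter> PiE UNIV I"
    then have \<nu>: "\<nu> \<in> L" "\<And>f. \<nu> f \<in> I f" by auto
    then have "f \<in> UCb \<Longrightarrow> (INF x. f x) \<le> \<nu> f \<and> \<nu> f \<le> (SUP x. f x)"
      and "f \<notin> UCb \<Longrightarrow> \<nu> f = 0" for f
      using \<nu>(2)[of f] unfolding I_def by auto
    then show "\<nu> \<in> ?M" using \<nu>(1) unfolding L_def is_mean_def by blast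
  qed
  ultimately show ?thesis using closed_Int_compact[OF _ cpt] by simp
qed

text \<open>For fixed \<open>f\<close> and \<open>g\<close> the invariance equation compares two coordinates of the mean, so it
  is a closed condition, and the finite intersection property applies. The set \<open>P\<close> of pairs
  allows two uses: one function with all translations, and all functions with all
  translations.\<close>

lemma invariant_mean_if_finitely:
  fixes P :: "(('a::topological_group_add \<Rightarrow> real) \<times> 'a) set"
  assumes UCb: "\<And>f g. (f, g) \<in> P \<Longrightarrow> f \<in> UCb"
    and fin: "\<And>Q. finite Q \<Longrightarrow> Q \<subseteq> P \<Longrightarrow> \<exists>\<nu>. is_mean \<nu> \<and> (\<forall>(f, g)\<in>Q. \<nu> (f \<circ> (+) g) = \<nu> f)"
  shows "\<exists>\<nu>. is_mean \<nu> \<and> (\<forall>(f, g)\<in>P. \<nu> (f \<circ> (+) g) = \<nu> f)"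
proof -
  define M where
    "M = {\<nu> :: ('a \<Rightarrow> real) \<Rightarrow> real. is_mean \<nu> \<and> (\<forall>f. f \<notin> UCb \<longrightarrow> \<nu> f = 0)}"
  define C where
    "C = (\<lambda>(f, g). {\<nu> :: ('a \<Rightarrow> real) \<Rightarrow> real. \<nu> (f \<circ> (+) g) = \<nu> f})"
  have "M \<inter> (\<Inter>p\<in>P. C p) \<noteq> {}"
  proof (rule compact_imp_fip_image)
    show "compact M" unfolding M_def by (rule compact_normalized_means)
    show "closed (C p)" if "p \<in> P" for p
      unfolding C_def by (cases p)
        (auto intro!: closed_Collect_eq continuous_on_product_coordinates)
  next
    fix Q assume Q: "finite Q" "Q \<subseteq> P"
    then obtain \<nu> where \<nu>: "is_mean \<nu>" "\<forall>(f, g)\<in>Q. \<nu> (f \<circ> (+) g) = \<nu> f"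
      using fin by blast
    define \<nu>' where "\<nu>' f = (if f \<in> UCb then \<nu> f else 0)" for f
    have "is_mean \<nu>'"
      using \<nu>(1) UCb_add UCb_cmult unfolding is_mean_def \<nu>'_def by auto
    moreover have "\<nu>' (f \<circ> (+) g) = \<nu>' f" if "(f, g) \<in> Q" for f g
      using that \<nu>(2) UCb[of f g] Q(2) UCb_left_translate[of f g] unfolding \<nu>'_def by auto
    ultimately have "\<nu>' \<in> M \<inter> (\<Inter>p\<in>Q. C p)"
      unfolding M_def C_def by (auto simp: \<nu>'_def)
    then show "M \<inter> (\<Inter>p\<in>Q. C p) \<noteq> {}" by blast
  qed
  then obtain \<nu> where "is_mean \<nu>" and C: "\<And>p. p \<in> P \<Longrightarrow> \<nu> \<in> C p"
    unfolding M_def by blast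
  moreover have "\<nu> (f \<circ> (+) g) = \<nu> f" if "(f, g) \<in> P" for f g
    using C[OF that] by (simp add: C_def)
  ultimately show ?thesis by blast
qed

section \<open>The characterization of amenability\<close>

lemma unit_interval_rescaling:
  fixes f :: "'a::topological_group_add \<Rightarrow> real"
  assumes f: "f \<in> UCb"
  obtains h a b where "h \<in> UCb" "range h \<subseteq> {0..1}" "f = (\<lambda>x. a * h x + b)"
proof -
  obtain B where B: "B > 0" "\<And>x. \<bar>f x\<bar> \<le> B" using UCb_boundedD[OF f] by blast
  define h where "h x = 1 / (2 * B) * f x + 1 / 2" for x
  have "h \<in> UCb" unfolding h_def by (intro UCb_add UCb_cmult UCb_const f)
  moreover have "h x \<in> {0..1}" for x
    using B(1) B(2)[of x] by (auto simp: h_def field_simps)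
  moreover have "f = (\<lambda>x. (2 * B) * h x + - B)"
    using B(1) by (auto simp: h_def field_simps)
  ultimately show thesis using that by blast
qed

lemma single_function_invariant_mean:
  fixes f :: "'a::topological_group_add \<Rightarrow> real"
  assumes hyp: "\<And>(E :: 'a set) h. finite E \<Longrightarrow> right_uniformly_continuous h \<Longrightarrow> range h \<subseteq> {0..1}
      \<Longrightarrow> \<exists>\<nu>. is_mean \<nu> \<and> (\<forall>g\<in>E. \<nu> (h \<circ> (+) g) = \<nu> h)"
    and f: "f \<in> UCb"
  shows "\<exists>\<nu>. is_mean \<nu> \<and> (\<forall>g. \<nu> (f \<circ> (+) g) = \<nu> f)"
proof -
  obtain h a b where h: "h \<in> UCb" "range h \<subseteq> {0..1}" and fh: "f = (\<lambda>x. a * h x + b)"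
    using unit_interval_rescaling[OF f] by blast
  have "\<exists>\<nu>. is_mean \<nu> \<and> (\<forall>(k, g) \<in> {h} \<times> UNIV. \<nu> (k \<circ> (+) g) = \<nu> k)"
  proof (rule invariant_mean_if_finitely)
    fix Q :: "(('a \<Rightarrow> real) \<times> 'a) set" assume Q: "finite Q" "Q \<subseteq> {h} \<times> UNIV"
    have "right_uniformly_continuous h" using h(1) by (simp add: UCb_def)
    with Q(1) h(2) obtain \<nu> where "is_mean \<nu>" "\<forall>g\<in>snd ` Q. \<nu> (h \<circ> (+) g) = \<nu> h"
      using hyp[of "snd ` Q" h] by blast
    moreover from this(2) Q(2) have "\<forall>(k, g)\<in>Q. \<nu> (k \<circ> (+) g) = \<nu> k" by fastforce
    ultimately show "\<exists>\<nu>. is_mean \<nu> \<and> (\<forall>(k, g)\<in>Q. \<nu> (k \<circ> (+) g) = \<nu> k)" by blast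
  qed (use h in auto)
  then obtain \<nu> where \<nu>: "is_mean \<nu>" "\<And>g. \<nu> (h \<circ> (+) g) = \<nu> h" by blast
  have affine: "\<nu> (\<lambda>x. a * k x + b) = a * \<nu> k + b" if "k \<in> UCb" for k
    using mean_add[OF \<nu>(1) UCb_cmult[OF that] UCb_const] mean_cmult[OF \<nu>(1) that]
      mean_const[OF \<nu>(1)] by simp
  have "\<nu> (f \<circ> (+) g) = \<nu> f" for g
    using affine[OF h(1)] affine[OF UCb_left_translate[OF h(1), of g]] \<nu>(2)[of g]
    unfolding fh comp_def by simp
  with \<nu>(1) show ?thesis by blast
qed

theorem corollary6p6:
  shows "amenable TYPE('a::{topological_group_add, t2_space}) \<longleftrightarrow>
    (\<forall>E :: 'a set. \<forall>f :: 'a \<Rightarrow> real.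
       finite E \<longrightarrow> right_uniformly_continuous f \<longrightarrow> range f \<subseteq> {0..1} \<longrightarrow>
       (\<exists>\<nu>. is_mean \<nu> \<and> (\<forall>g\<in>E. \<nu> (f \<circ> (+) g) = \<nu> f)))"
    (is "_ \<longleftrightarrow> ?R")
proof
  assume "amenable TYPE('a)"
  then obtain \<nu> :: "('a \<Rightarrow> real) \<Rightarrow> real"
    where \<nu>: "is_mean \<nu>" "\<forall>f\<in>UCb. \<forall>g. \<nu> (f \<circ> (+) g) = \<nu> f"
    unfolding amenable_def by blast
  have "f \<in> UCb" if "right_uniformly_continuous f" "range f \<subseteq> {0..1}" for f :: "'a \<Rightarrow> real"
    using that bounded_subset[OF bounded_closed_interval] by (auto simp: UCb_def)
  with \<nu> show ?R by blast
next
  assume ?R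
  then have single: "\<exists>\<nu>. is_mean \<nu> \<and> (\<forall>g. \<nu> (f \<circ> (+) g) = \<nu> f)"
    if "f \<in> UCb" for f :: "'a \<Rightarrow> real"
    using single_function_invariant_mean that by blast
  have "\<exists>\<nu>. is_mean \<nu> \<and> (\<forall>(f, g) \<in> UCb \<times> (UNIV :: 'a set). \<nu> (f \<circ> (+) g) = \<nu> f)"
  proof (rule invariant_mean_if_finitely)
    fix Q :: "(('a \<Rightarrow> real) \<times> 'a) set" assume Q: "finite Q" "Q \<subseteq> UCb \<times> UNIV"
    then obtain \<nu> where "is_mean \<nu>" "\<forall>f\<in>fst ` Q. \<forall>g. \<nu> (f \<circ> (+) g) = \<nu> f"
      using finite_set_invariant_mean[OF single, of "fst ` Q"] by fastforce
    moreover from this(2) have "\<forall>(f, g)\<in>Q. \<nu> (f \<circ> (+) g) = \<nu> f" by fastforce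
    ultimately show "\<exists>\<nu>. is_mean \<nu> \<and> (\<forall>(f, g)\<in>Q. \<nu> (f \<circ> (+) g) = \<nu> f)" by blast
  qed auto
  then show "amenable TYPE('a)" unfolding amenable_def by blast
qed

end
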